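(* Let $G$ be an undirected graph, let $p,q\ge 0$ be two integers, and let $\mu:2^{V(G)}\to \mathbb{Z}_{\ge 0}$ be a monotone function. If every $v\in V(G)$ is contained in some $(\mu,p,q)$-cluster, then $G$ has a $(\mu,p,q)$-partition. Furthermore, given a set of $(\mu,p,q)$-clusters $C_1,\dots,C_n$ whose union is $V(G)$, a $(\mu,p,q)$-partition of $G$ can be found in polynomial time.
   Context: For $X\subseteq V(G)$, $\Delta(X)$ is the set of edges of $G$ between $X$ and $V(G)\setminus X$, and $d(X)=|\Delta(X)|$. A function $\mu:2^{V(G)}\to\mathbb{Z}_{\ge 0}$ is monotone if $\mu(X)\le\mu(Y)$ whenever $X\subseteq Y$. A set $C\subseteq V(G)$ is a $(\mu,p,q)$-cluster if $\mu(C)\le p$ and $d(C)\le q$. A $(\mu,p,q)$-partition of $G$ is a partition of $V(G)$ into $(\mu,p,q)$-clusters. *)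

theory Defs
  imports Main "HOL-Library.Disjoint_Sets" "HOL-Computational_Algebra.Polynomial"
begin

section \<open>Graphs, clusters and partitions\<close>

text \<open>Finite simple undirected graphs: edges are two-element sets of vertices.\<close>

definition ugraph :: "'a set \<Rightarrow> 'a set set \<Rightarrow> bool" where
  "ugraph V E \<longleftrightarrow> finite V \<and> E \<subseteq> {{u, v} | u v. u \<in> V \<and> v \<in> V \<and> u \<noteq> v}"

definition boundary :: "'a set \<Rightarrow> 'a set set \<Rightarrow> 'a set \<Rightarrow> 'a set set" where
  "boundary V E X = {e \<in> E. \<exists>u\<in>X. \<exists>v\<in>V - X. e = {u, v}}"

definition cut_size :: "'a set \<Rightarrow> 'a set set \<Rightarrow> 'a set \<Rightarrow> nat" where
  "cut_size V E X = card (boundary V E X)"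

definition is_cluster ::
  "'a set \<Rightarrow> 'a set set \<Rightarrow> ('a set \<Rightarrow> nat) \<Rightarrow> nat \<Rightarrow> nat \<Rightarrow> 'a set \<Rightarrow> bool" where
  "is_cluster V E \<mu> p q C \<longleftrightarrow> C \<subseteq> V \<and> \<mu> C \<le> p \<and> cut_size V E C \<le> q"

definition is_cluster_partition ::
  "'a set \<Rightarrow> 'a set set \<Rightarrow> ('a set \<Rightarrow> nat) \<Rightarrow> nat \<Rightarrow> nat \<Rightarrow> 'a set set \<Rightarrow> bool" where
  "is_cluster_partition V E \<mu> p q P \<longleftrightarrow>
     partition_on V P \<and> (\<forall>C\<in>P. is_cluster V E \<mu> p q C)"


section \<open>A model of computation\<close>

text \<open>
  Running time is measured in Jones's WHILE language over binary trees ("Computability and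
  Complexity from a Programming Perspective").  Every elementary operation takes unit time: trees
  are pointer structures, so pairing and projection are constant-time, and there is no built-in
  comparison of trees other than the test for \<open>Atom\<close>.  The functions computable in polynomial time
  in this model are those computable in polynomial time by Turing machines.
\<close>

datatype val = Atom | Pair val val

datatype exp = Var nat | Nil_exp | Cons_exp exp exp | Hd exp | Tl exp

datatype com =
    Skip
  | Assign nat exp
  | Seq com com
  | Cond exp com com
  | While exp com

type_synonym state = "nat \<Rightarrow> val"

fun val_hd :: "val \<Rightarrow> val" where
  "val_hd Atom = Atom"
| "val_hd (Pair a b) = a"

fun val_tl :: "val \<Rightarrow> val" where
  "val_tl Atom = Atom"
| "val_tl (Pair a b) = b"

fun eval_exp :: "exp \<Rightarrow> state \<Rightarrow> val" where
  "eval_exp (Var x) s = s x"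
| "eval_exp Nil_exp s = Atom"
| "eval_exp (Cons_exp a b) s = Pair (eval_exp a s) (eval_exp b s)"
| "eval_exp (Hd a) s = val_hd (eval_exp a s)"
| "eval_exp (Tl a) s = val_tl (eval_exp a s)"

fun exp_cost :: "exp \<Rightarrow> nat" where
  "exp_cost (Var x) = 1"
| "exp_cost Nil_exp = 1"
| "exp_cost (Cons_exp a b) = exp_cost a + exp_cost b + 1"
| "exp_cost (Hd a) = exp_cost a + 1"
| "exp_cost (Tl a) = exp_cost a + 1"

text \<open>\<open>exec c s t s'\<close>: started in \<open>s\<close>, the command \<open>c\<close> halts in \<open>s'\<close> after exactly \<open>t\<close> time units.\<close>

inductive exec :: "com \<Rightarrow> state \<Rightarrow> nat \<Rightarrow> state \<Rightarrow> bool" where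
  exec_Skip: "exec Skip s 1 s"
| exec_Assign: "exec (Assign x e) s (exp_cost e + 1) (s(x := eval_exp e s))"
| exec_Seq: "exec c1 s t1 s' \<Longrightarrow> exec c2 s' t2 s'' \<Longrightarrow> exec (Seq c1 c2) s (t1 + t2 + 1) s''"
| exec_IfTrue: "eval_exp e s \<noteq> Atom \<Longrightarrow> exec c1 s t s' \<Longrightarrow>
    exec (Cond e c1 c2) s (exp_cost e + t + 1) s'"
| exec_IfFalse: "eval_exp e s = Atom \<Longrightarrow> exec c2 s t s' \<Longrightarrow>
    exec (Cond e c1 c2) s (exp_cost e + t + 1) s'"
| exec_WhileFalse: "eval_exp e s = Atom \<Longrightarrow> exec (While e c) s (exp_cost e + 1) s"
| exec_WhileTrue: "eval_exp e s \<noteq> Atom \<Longrightarrow> exec c s t1 s' \<Longrightarrow> exec (While e c) s' t2 s'' \<Longrightarrow>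
    exec (While e c) s (exp_cost e + t1 + t2 + 1) s''"

text \<open>
  The input is read from variable 0 and the output is left in variable 1.  The automatically defined
  \<open>size\<close> of a tree, used as the input length, is its number of pairs.
\<close>

definition computes_in :: "com \<Rightarrow> val \<Rightarrow> val \<Rightarrow> nat \<Rightarrow> bool" where
  "computes_in c x y t \<longleftrightarrow> (\<exists>s. exec c ((\<lambda>_. Atom)(0 := x)) t s \<and> s 1 = y)"


section \<open>Encoding of instances\<close>

text \<open>
  Relative to a listing \<open>vs\<close> of the vertices without repetition, a graph is given by its adjacency
  matrix and a vertex set by its characteristic vector.
\<close>

fun enc_bool :: "bool \<Rightarrow> val" where
  "enc_bool False = Atom"
| "enc_bool True = Pair Atom Atom"

fun enc_list :: "('b \<Rightarrow> val) \<Rightarrow> 'b list \<Rightarrow> val" where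
  "enc_list f [] = Atom"
| "enc_list f (x # xs) = Pair (f x) (enc_list f xs)"

definition enc_set :: "'a list \<Rightarrow> 'a set \<Rightarrow> val" where
  "enc_set vs X = enc_list (\<lambda>v. enc_bool (v \<in> X)) vs"

definition enc_graph :: "'a list \<Rightarrow> 'a set set \<Rightarrow> val" where
  "enc_graph vs E = enc_list (\<lambda>u. enc_list (\<lambda>v. enc_bool ({u, v} \<in> E)) vs) vs"

definition enc_family :: "'a list \<Rightarrow> 'a set list \<Rightarrow> val" where
  "enc_family vs Cs = enc_list (enc_set vs) Cs"

definition enc_instance :: "'a list \<Rightarrow> 'a set set \<Rightarrow> 'a set list \<Rightarrow> val" where
  "enc_instance vs E Cs = Pair (enc_graph vs E) (enc_family vs Cs)"

end

theory Submission imports Defs begin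

text \<open>
  By posimodularity, \<open>d(X - Y) + d(Y - X) \<le> d(X) + d(Y)\<close>, so of two clusters \<open>X\<close>, \<open>Y\<close> one may be
  replaced by its difference with the other: it stays a cluster because \<open>\<mu>\<close> is monotone, and the
  union does not change.  Inserting the given clusters one at a time into a disjoint family takes
  one uncrossing per member of the family, hence polynomially many altogether.  Which of the two
  sets to shrink is decided by comparing \<open>d(X - Y)\<close> with \<open>d(X)\<close>, without knowing \<open>\<mu>\<close>, \<open>p\<close> or \<open>q\<close>.
\<close>

section \<open>Uncrossing\<close>

lemma boundary_iff:
  assumes "ugraph V E" "X \<subseteq> V"
  shows "e \<in> boundary V E X \<longleftrightarrow> e \<in> E \<and> (\<exists>u v. e = {u, v} \<and> u \<in> V \<and> v \<in> V \<and> u \<in> X \<and> v \<notin> X)"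
  using assms by (auto simp: boundary_def)

lemma finite_edges: "ugraph V E \<Longrightarrow> finite E"
  unfolding ugraph_def by (rule finite_subset[of E "Pow V"]) auto

text \<open>An edge leaving \<open>X - Y\<close> or \<open>Y - X\<close> leaves \<open>X\<close> or
  \<open>Y\<close>, and an edge leaving both differences joins one to the other, so it leaves both
  \<open>X\<close> and \<open>Y\<close>. Unions and intersections of boundaries are thus nested, and
  \<open>card_Un_Int\<close> turns this into the inequality of sums.\<close>

lemma cut_size_posimodular:
  assumes G: "ugraph V E" and X: "X \<subseteq> V" and Y: "Y \<subseteq> V"
  shows "cut_size V E (X - Y) + cut_size V E (Y - X) \<le> cut_size V E X + cut_size V E Y"
proof -
  let ?b = "boundary V E"
  have fin: "finite (?b Z)" for Z
    using finite_edges[OF G] by (simp add: boundary_def)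
  have XY: "X - Y \<subseteq> V" "Y - X \<subseteq> V" using X Y by auto
  have un: "?b (X - Y) \<union> ?b (Y - X) \<subseteq> ?b X \<union> ?b Y"
    unfolding subset_iff Un_iff boundary_iff[OF G X] boundary_iff[OF G Y]
      boundary_iff[OF G XY(1)] boundary_iff[OF G XY(2)]
    by (metis DiffD1 DiffD2 DiffI insert_commute)
  have int: "?b (X - Y) \<inter> ?b (Y - X) \<subseteq> ?b X \<inter> ?b Y"
    unfolding subset_iff Int_iff boundary_iff[OF G X] boundary_iff[OF G Y]
      boundary_iff[OF G XY(1)] boundary_iff[OF G XY(2)]
    by (auto simp: doubleton_eq_iff)
  have "card (?b (X - Y)) + card (?b (Y - X))
      = card (?b (X - Y) \<union> ?b (Y - X)) + card (?b (X - Y) \<inter> ?b (Y - X))"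
    by (rule card_Un_Int) (rule fin)+
  also have "\<dots> \<le> card (?b X \<union> ?b Y) + card (?b X \<inter> ?b Y)"
    by (intro add_mono card_mono un int) (auto simp: fin)
  also have "\<dots> = card (?b X) + card (?b Y)"
    by (rule card_Un_Int[symmetric]) (rule fin)+
  finally show ?thesis by (simp add: cut_size_def)
qed

text \<open>Makes \<open>C\<close> disjoint from each member of a disjoint family in a single pass: \<open>C\<close> only shrinks,
  so it stays disjoint from the members already treated.\<close>

fun uncross :: "('a set \<Rightarrow> nat) \<Rightarrow> 'a set \<Rightarrow> 'a set list \<Rightarrow> 'a set list \<Rightarrow> 'a set list" where
  "uncross d C Ps [] = C # Ps"
| "uncross d C Ps (D # Ds) =
     (if d (C - D) \<le> d C then uncross d (C - D) (D # Ps) Ds else uncross d C ((D - C) # Ps) Ds)"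

lemma length_uncross [simp]: "length (uncross d C Ps Ds) = Suc (length Ps + length Ds)"
  by (induction Ds arbitrary: C Ps) auto

lemma Union_uncross: "\<Union>(set (uncross d C Ps Ds)) = C \<union> \<Union>(set Ps) \<union> \<Union>(set Ds)"
  by (induction Ds arbitrary: C Ps) auto

text \<open>Either replacement makes \<open>C\<close> and \<open>D\<close> disjoint, so one more
  member counts as treated; since sets only shrink, the disjointness already achieved
  persists.\<close>

lemma uncross_disjnt:
  assumes "sorted_wrt disjnt Ps" "sorted_wrt disjnt Ds"
    "\<forall>P\<in>set Ps. disjnt C P \<and> (\<forall>D\<in>set Ds. disjnt P D)"
  shows "sorted_wrt disjnt (uncross d C Ps Ds)"
  using assms
proof (induction Ds arbitrary: C Ps)
  case (Cons D Ds)
  show ?case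
  proof (cases "d (C - D) \<le> d C")
    case True
    have "sorted_wrt disjnt (uncross d (C - D) (D # Ps) Ds)"
      by (rule Cons.IH) (use Cons.prems in \<open>auto simp: disjnt_def\<close>)
    with True show ?thesis by simp
  next
    case False
    have "sorted_wrt disjnt (uncross d C ((D - C) # Ps) Ds)"
      by (rule Cons.IH) (use Cons.prems in \<open>auto simp: disjnt_def\<close>)
    with False show ?thesis by simp
  qed
qed auto

text \<open>For \<open>K\<close> read "is a cluster" and for \<open>d\<close> the cut size; the
  first assumption is what posimodularity yields. When the test on \<open>C - D\<close> fails, that
  assumption makes it safe to shrink \<open>D\<close> instead.\<close>

lemma uncross_invariant:
  assumes "\<And>X Y. K X \<Longrightarrow> K Y \<Longrightarrow> d (X - Y) \<le> d X \<or> d (Y - X) \<le> d Y"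
    and "\<And>X Y. K X \<Longrightarrow> d (X - Y) \<le> d X \<Longrightarrow> K (X - Y)"
    and "K C" "\<forall>P\<in>set Ps. K P" "\<forall>D\<in>set Ds. K D"
  shows "\<forall>P\<in>set (uncross d C Ps Ds). K P"
  using assms(3-)
proof (induction Ds arbitrary: C Ps)
  case (Cons D Ds)
  show ?case
  proof (cases "d (C - D) \<le> d C")
    case True
    then have "\<forall>P\<in>set (uncross d (C - D) (D # Ps) Ds). K P"
      using Cons.prems assms(2) by (intro Cons.IH) auto
    with True show ?thesis by simp
  next
    case False
    then have "d (D - C) \<le> d D" using Cons.prems assms(1)[of C D] by auto
    then have "\<forall>P\<in>set (uncross d C ((D - C) # Ps) Ds). K P"
      using Cons.prems assms(2) by (intro Cons.IH) auto
    with False show ?thesis by simp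
  qed
qed auto

text \<open>Blocks of a partition must be nonempty, hence the filter. The reversal matches the
  program, which filters by pushing onto an output list.\<close>

definition uncross_all :: "('a set \<Rightarrow> nat) \<Rightarrow> 'a set list \<Rightarrow> 'a set list" where
  "uncross_all d Cs = rev (filter (\<lambda>C. C \<noteq> {}) (fold (\<lambda>C Ps. uncross d C [] Ps) Cs []))"

text \<open>A repeated entry would be disjoint from itself, hence empty.\<close>

lemma disjnt_list_distinct:
  assumes "sorted_wrt disjnt Ps" "{} \<notin> set Ps"
  shows "distinct Ps \<and> disjoint (set Ps)"
  using assms by (induction Ps) (auto simp: disjnt_def disjoint_def)

lemma uncross_all_correct:
  assumes G: "ugraph V E" and mu: "mono_on (Pow V) \<mu>"
    and Cs: "\<forall>C\<in>set Cs. is_cluster V E \<mu> p q C" and U: "\<Union>(set Cs) = V"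
  defines "Ps \<equiv> uncross_all (cut_size V E) Cs"
  shows "distinct Ps" "is_cluster_partition V E \<mu> p q (set Ps)"
proof -
  let ?K = "is_cluster V E \<mu> p q" and ?d = "cut_size V E"
  let ?R = "\<lambda>Cs Qs. fold (\<lambda>C Ps. uncross ?d C [] Ps) Cs Qs"
  \<comment> \<open>If both cuts grew strictly, their sum would violate posimodularity.\<close>
  have one: "?d (X - Y) \<le> ?d X \<or> ?d (Y - X) \<le> ?d Y" if "?K X" "?K Y" for X Y
    using cut_size_posimodular[OF G, of X Y] that by (auto simp: is_cluster_def)
  have shrink: "?K (X - Y)" if "?K X" "?d (X - Y) \<le> ?d X" for X Y
  proof -
    have "\<mu> (X - Y) \<le> \<mu> X"
      using mu that(1) by (intro mono_onD[OF mu]) (auto simp: is_cluster_def)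
    with that show ?thesis by (auto simp: is_cluster_def)
  qed
  \<comment> \<open>The start family \<open>Qs\<close> is arbitrary because the induction on
    \<open>Cs\<close> resumes the fold from the family built so far.\<close>
  have "sorted_wrt disjnt (?R Cs Qs) \<and> (\<forall>P\<in>set (?R Cs Qs). ?K P)
      \<and> \<Union>(set (?R Cs Qs)) = \<Union>(set Cs) \<union> \<Union>(set Qs)"
    if "sorted_wrt disjnt Qs" "\<forall>Q\<in>set Qs. ?K Q" for Qs
    using Cs that
  proof (induction Cs arbitrary: Qs)
    case (Cons C Cs)
    have "sorted_wrt disjnt (uncross ?d C [] Qs)"
      using Cons.prems by (intro uncross_disjnt) auto
    moreover have "\<forall>P\<in>set (uncross ?d C [] Qs). ?K P"
    proof (rule uncross_invariant[of ?K ?d])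
      show "?K C" "\<forall>P\<in>set []. ?K P" "\<forall>D\<in>set Qs. ?K D" using Cons.prems by auto
    qed (fact one shrink)+
    ultimately have *: "sorted_wrt disjnt (uncross ?d C [] Qs)" "\<forall>P\<in>set (uncross ?d C [] Qs). ?K P"
      by blast+
    from Cons.IH[OF _ *] Cons.prems show ?case by (auto simp: Union_uncross)
  qed simp
  from this[of "[]"] have R: "sorted_wrt disjnt (?R Cs [])" "\<forall>P\<in>set (?R Cs []). ?K P"
    "\<Union>(set (?R Cs [])) = V" using U by auto
  let ?F = "filter (\<lambda>C. C \<noteq> {}) (?R Cs [])"
  have "distinct ?F \<and> disjoint (set ?F)"
    using R(1) by (intro disjnt_list_distinct sorted_wrt_filter) auto
  moreover have "\<Union>(set ?F) = V" using R(3) by auto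
  ultimately show "distinct Ps" "is_cluster_partition V E \<mu> p q (set Ps)"
    using R(2) by (auto simp: Ps_def uncross_all_def is_cluster_partition_def partition_on_def)
qed

section \<open>Timed weakest preconditions\<close>

text \<open>Total correctness within a time budget. An upper bound in place of the exact time of
  \<open>exec\<close> lets runs through different branches share one bound.\<close>

definition wp :: "com \<Rightarrow> state \<Rightarrow> nat \<Rightarrow> (state \<Rightarrow> bool) \<Rightarrow> bool" where
  "wp c s T Q \<longleftrightarrow> (\<exists>t s'. exec c s t s' \<and> t \<le> T \<and> Q s')"

lemma wp_le: "wp c s T Q \<Longrightarrow> T \<le> T' \<Longrightarrow> wp c s T' Q"
  unfolding wp_def by (meson le_trans)

lemma wp_conseq: "wp c s T Q \<Longrightarrow> (\<And>s'. Q s' \<Longrightarrow> Q' s') \<Longrightarrow> wp c s T Q'"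
  unfolding wp_def by blast

lemma wp_Skip: "Q s \<Longrightarrow> wp Skip s 1 Q"
  unfolding wp_def by (blast intro: exec.intros)

lemma wp_Assign: "Q (s(x := eval_exp e s)) \<Longrightarrow> wp (Assign x e) s (exp_cost e + 1) Q"
  unfolding wp_def by (blast intro: exec.intros)

lemma wp_Seq:
  assumes "wp c1 s T1 (\<lambda>s'. wp c2 s' T2 Q)"
  shows "wp (Seq c1 c2) s (T1 + T2 + 1) Q"
proof -
  from assms obtain t1 s1 t2 s2 where *: "exec c1 s t1 s1" "t1 \<le> T1" "exec c2 s1 t2 s2" "t2 \<le> T2" "Q s2"
    unfolding wp_def by blast
  then have "exec (Seq c1 c2) s (t1 + t2 + 1) s2" by (intro exec.intros)
  with * show ?thesis unfolding wp_def by (intro exI[of _ "t1 + t2 + 1"] exI[of _ s2]) auto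
qed

text \<open>The sum of the two branch bounds stands in for their maximum, which keeps the time
  bounds plain arithmetic terms.\<close>

lemma wp_Cond:
  assumes "eval_exp e s \<noteq> Atom \<Longrightarrow> wp c1 s T1 Q" "eval_exp e s = Atom \<Longrightarrow> wp c2 s T2 Q"
  shows "wp (Cond e c1 c2) s (exp_cost e + (T1 + T2) + 1) Q"
proof (cases "eval_exp e s = Atom")
  case True
  with assms obtain t s' where *: "exec c2 s t s'" "t \<le> T2" "Q s'" unfolding wp_def by blast
  from exec_IfFalse[OF True *(1)] * show ?thesis unfolding wp_def
    by (intro exI[of _ "exp_cost e + t + 1"] exI[of _ s']) auto
next
  case False
  with assms obtain t s' where *: "exec c1 s t s'" "t \<le> T1" "Q s'" unfolding wp_def by blast
  from exec_IfTrue[OF False *(1)] * show ?thesis unfolding wp_def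
    by (intro exI[of _ "exp_cost e + t + 1"] exI[of _ s']) auto
qed

text \<open>The ghost list \<open>xs\<close> holds the entries still to be processed: each iteration
  removes its head, so its length counts the iterations. The bound \<open>T\<close> on the body is
  uniform over all iterations.\<close>

lemma wp_While:
  assumes "P xs s"
    and step: "\<And>x xs s. P (x # xs) s \<Longrightarrow> eval_exp e s \<noteq> Atom \<and> wp c s T (P xs)"
    and stop: "\<And>s. P [] s \<Longrightarrow> eval_exp e s = Atom \<and> Q s"
    and time: "(exp_cost e + T + 1) * length xs + exp_cost e + 1 \<le> T'"
  shows "wp (While e c) s T' Q"
proof -
  have "wp (While e c) s ((exp_cost e + T + 1) * length xs + exp_cost e + 1) Q"
    using assms(1)
  proof (induction xs arbitrary: s)
    case Nil
    from stop[OF Nil] have *: "eval_exp e s = Atom" "Q s" by auto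
    from exec_WhileFalse[OF *(1)] *(2) show ?case unfolding wp_def by fastforce
  next
    case (Cons x xs)
    from step[OF Cons.prems] obtain t1 s1
      where 1: "eval_exp e s \<noteq> Atom" "exec c s t1 s1" "t1 \<le> T" "P xs s1" unfolding wp_def by blast
    from Cons.IH[OF 1(4)] obtain t2 s2 where 2: "exec (While e c) s1 t2 s2"
      "t2 \<le> (exp_cost e + T + 1) * length xs + exp_cost e + 1" "Q s2" unfolding wp_def by blast
    from exec_WhileTrue[OF 1(1,2) 2(1)] 1(3) 2(2,3) show ?case unfolding wp_def
      by (intro exI[of _ "exp_cost e + t1 + t2 + 1"] exI[of _ s2]) auto
  qed
  then show ?thesis
    using time by (rule wp_le)
qed

text \<open>The values of \<open>run\<close> and \<open>cost\<close> on loops are junk.\<close>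

primrec loop_free :: "com \<Rightarrow> bool" where
  "loop_free Skip = True"
| "loop_free (Assign x e) = True"
| "loop_free (Seq c1 c2) = (loop_free c1 \<and> loop_free c2)"
| "loop_free (Cond e c1 c2) = (loop_free c1 \<and> loop_free c2)"
| "loop_free (While e c) = False"

primrec run :: "com \<Rightarrow> state \<Rightarrow> state" where
  "run Skip s = s"
| "run (Assign x e) s = s(x := eval_exp e s)"
| "run (Seq c1 c2) s = run c2 (run c1 s)"
| "run (Cond e c1 c2) s = (if eval_exp e s = Atom then run c2 s else run c1 s)"
| "run (While e c) s = s"

primrec cost :: "com \<Rightarrow> nat" where
  "cost Skip = 1"
| "cost (Assign x e) = exp_cost e + 1"
| "cost (Seq c1 c2) = cost c1 + cost c2 + 1"
| "cost (Cond e c1 c2) = exp_cost e + (cost c1 + cost c2) + 1"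
| "cost (While e c) = 0"

text \<open>Loop-free code is thereby handled by symbolic evaluation in the simplifier; only loops
  call for invariants.\<close>

lemma wp_run: "loop_free c \<Longrightarrow> Q (run c s) \<Longrightarrow> wp c s (cost c) Q"
proof (induction c arbitrary: s Q)
  case Skip
  then show ?case using wp_Skip by simp
next
  case (Assign x e)
  then show ?case using wp_Assign[of Q s x e] by (simp add: fun_upd_def)
next
  case (Seq c1 c2)
  then show ?case using wp_Seq[of c1 s "cost c1" c2 "cost c2" Q] by simp
next
  case (Cond e c1 c2)
  then show ?case using wp_Cond[of e s c1 "cost c1" Q c2 "cost c2"] by (simp split: if_splits)
qed simp

lemma wp_run_le: "loop_free c \<Longrightarrow> cost c \<le> T \<Longrightarrow> Q (run c s) \<Longrightarrow> wp c s T Q"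
  by (blast intro: wp_le wp_run)

section \<open>The uncrossing program\<close>

text \<open>
  Registers: 2 graph, 3 clusters still to be inserted, 4 disjoint family being built, 5 cluster
  being inserted, 6 members of the family still to be uncrossed with it, 7 current member,
  9 difference of 5 and 7, 11 unary counter; 12 to 17 are scratch.
\<close>

notation Seq (infixr \<open>;;\<close> 60)

lemma enc_bool_eq_Atom [simp]: "enc_bool b = Atom \<longleftrightarrow> \<not> b"
  by (cases b) auto

lemma enc_set_simps [simp]:
  "enc_set [] X = Atom"
  "enc_set (v # vs) X = Pair (enc_bool (v \<in> X)) (enc_set vs X)"
  by (simp_all add: enc_set_def)

lemma enc_family_simps [simp]:
  "enc_family vs [] = Atom"
  "enc_family vs (C # Cs) = Pair (enc_set vs C) (enc_family vs Cs)"
  by (simp_all add: enc_family_def)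

abbreviation same_off :: "nat set \<Rightarrow> state \<Rightarrow> state \<Rightarrow> bool" where
  "same_off M s s' \<equiv> \<forall>x. x \<notin> M \<longrightarrow> s' x = s x"

subsection \<open>Set difference\<close>

text \<open>Lists are read from the front and built by prepending, so the result appears in register
  14 in reverse; \<open>rev_loop\<close> restores the vertex order.\<close>

definition diff_loop :: com where
  "diff_loop =
    While (Var 12) (
      Cond (Hd (Var 12))
        (Cond (Hd (Var 13))
          (Assign 14 (Cons_exp Nil_exp (Var 14)))
          (Assign 14 (Cons_exp (Cons_exp Nil_exp Nil_exp) (Var 14))))
        (Assign 14 (Cons_exp Nil_exp (Var 14))) ;;
      Assign 12 (Tl (Var 12)) ;;
      Assign 13 (Tl (Var 13)))"

definition rev_loop :: "nat \<Rightarrow> com" where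
  "rev_loop z =
    While (Var 14) (
      Assign z (Cons_exp (Hd (Var 14)) (Var z)) ;;
      Assign 14 (Tl (Var 14)))"

text \<open>The operands are copied to scratch registers and \<open>z\<close> is cleared only after
  they have been read, so \<open>z\<close> may coincide with \<open>x\<close> or \<open>y\<close>,
  as in \<open>diff_com 7 5 7\<close>.\<close>

definition diff_com :: "nat \<Rightarrow> nat \<Rightarrow> nat \<Rightarrow> com" where
  "diff_com x y z =
    Assign 12 (Var x) ;; Assign 13 (Var y) ;; Assign 14 Nil_exp ;;
    diff_loop ;; Assign z Nil_exp ;; rev_loop z"

lemma wp_diff_loop:
  assumes "s 12 = enc_set vs X" "s 13 = enc_set vs Y" "s 14 = Atom"
  shows "wp diff_loop s (30 * length vs + 2)
    (\<lambda>s'. s' 14 = enc_set (rev vs) (X - Y) \<and> same_off {12, 13, 14} s s')"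
proof -
  \<comment> \<open>Here \<open>us\<close> is the unread part of the listing and \<open>ws\<close>
    the part already read, in reverse.\<close>
  let ?P = "\<lambda>us s'. s' 12 = enc_set us X \<and> s' 13 = enc_set us Y \<and>
    (\<exists>ws. s' 14 = enc_set ws (X - Y) \<and> rev ws @ us = vs) \<and> same_off {12, 13, 14} s s'"
  show ?thesis
    unfolding diff_loop_def
  proof (rule wp_While[where P = ?P and xs = vs])
    show "?P vs s" using assms by simp
    fix v us s' assume P: "?P (v # us) s'"
    then obtain ws where ws: "s' 14 = enc_set ws (X - Y)" "rev ws @ v # us = vs" by blast
    have *: "\<exists>ws'. Pair (enc_bool (v \<in> X - Y)) (enc_set ws (X - Y)) = enc_set ws' (X - Y) \<and> rev ws' @ us = vs"
      using ws by (intro exI[of _ "v # ws"]) simp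
    show "eval_exp (Var 12) s' \<noteq> Atom \<and> wp 
       (Cond (Hd (Var 12))
        (Cond (Hd (Var 13))
          (Assign 14 (Cons_exp Nil_exp (Var 14)))
          (Assign 14 (Cons_exp (Cons_exp Nil_exp Nil_exp) (Var 14))))
        (Assign 14 (Cons_exp Nil_exp (Var 14))) ;;
      Assign 12 (Tl (Var 12)) ;;
      Assign 13 (Tl (Var 13))) s' 28 (?P us)"
      apply (rule conjI)
      subgoal using P by simp
      apply (rule wp_run_le)
      subgoal by simp
      subgoal by simp
      using P * by (cases "v \<in> X"; cases "v \<in> Y") (simp_all add: ws)
  qed auto
qed

lemma wp_rev_loop:
  assumes "s 14 = enc_set ws X" "s z = Atom" "z < 12"
  shows "wp (rev_loop z) s (12 * length ws + 2)
    (\<lambda>s'. s' z = enc_set (rev ws) X \<and> same_off {14, z} s s')"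
  unfolding rev_loop_def
proof (rule wp_While[where P = "\<lambda>us s'. s' 14 = enc_set us X \<and>
    (\<exists>vs. s' z = enc_set vs X \<and> rev us @ vs = rev ws) \<and> same_off {14, z} s s'" and xs = ws])
  fix v us s'
  assume P: "s' 14 = enc_set (v # us) X \<and>
    (\<exists>vs. s' z = enc_set vs X \<and> rev (v # us) @ vs = rev ws) \<and> same_off {14, z} s s'"
  then obtain vs where vs: "s' z = enc_set vs X" "rev (v # us) @ vs = rev ws" by blast
  then have *: "\<exists>vs'. Pair (enc_bool (v \<in> X)) (enc_set vs X) = enc_set vs' X \<and> rev us @ vs' = rev ws"
    by (intro exI[of _ "v # vs"]) simp
  show "eval_exp (Var 14) s' \<noteq> Atom \<and>
      wp (Assign z (Cons_exp (Hd (Var 14)) (Var z)) ;; Assign 14 (Tl (Var 14))) s' 10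
       (\<lambda>s'. s' 14 = enc_set us X \<and>
    (\<exists>vs. s' z = enc_set vs X \<and> rev us @ vs = rev ws) \<and> same_off {14, z} s s')"
    apply (rule conjI)
    subgoal using P by simp
    apply (rule wp_run_le)
    using P * \<open>z < 12\<close> by (simp_all add: vs)
qed (use assms in auto)

lemma wp_diff_com:
  assumes "s x = enc_set vs X" "s y = enc_set vs Y" "x < 12" "y < 12" "z < 12"
  shows "wp (diff_com x y z) s (42 * length vs + 17)
    (\<lambda>s'. s' z = enc_set vs (X - Y) \<and> same_off {12, 13, 14, z} s s')"
  unfolding diff_com_def
  apply (rule wp_le)
   apply (rule wp_Seq wp_Assign)+
   apply (rule wp_conseq[OF wp_diff_loop[where vs = vs and X = X and Y = Y]])
  subgoal using assms by simp
  subgoal using assms by simp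
  subgoal by simp
   apply (rule wp_Seq wp_Assign)+
   apply (rule wp_conseq[OF wp_rev_loop[where ws = "rev vs" and X = "X - Y"]])
  using assms by auto

subsection \<open>Comparing cut sizes\<close>

text \<open>The counter is pushed \<open>d(X - Y)\<close> times and then popped \<open>d(X)\<close> times; as the tail of \<open>Atom\<close> is
  \<open>Atom\<close>, it ends up empty iff \<open>d(X - Y) \<le> d(X)\<close>.  In the loop invariants below, the number of
  applications of \<open>f\<close> still to come is added to those already made.\<close>

definition cut_row :: "'a set set \<Rightarrow> 'a set \<Rightarrow> 'a list \<Rightarrow> 'a \<Rightarrow> nat" where
  "cut_row E X vs u = length (filter (\<lambda>v. v \<notin> X \<and> {u, v} \<in> E) vs)"

text \<open>Rows \<open>us\<close> and columns \<open>vs\<close> are separate arguments: the outer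
  loop uses up the rows, while each row keeps all its columns.\<close>

definition cut_rows :: "'a set set \<Rightarrow> 'a set \<Rightarrow> 'a list \<Rightarrow> 'a list \<Rightarrow> nat" where
  "cut_rows E X vs us = (\<Sum>u\<leftarrow>filter (\<lambda>u. u \<in> X) us. cut_row E X vs u)"

text \<open>The matrix scan counts ordered pairs from \<open>X\<close> to its complement. Each
  boundary edge has exactly one such orientation, so forgetting the order is a bijection onto the
  boundary.\<close>

lemma cut_rows_eq_cut_size:
  assumes "X \<subseteq> set vs" "distinct vs"
  shows "cut_rows E X vs vs = cut_size (set vs) E X"
proof -
  let ?S = "Sigma (set vs \<inter> X) (\<lambda>u. {v \<in> set vs. v \<notin> X \<and> {u, v} \<in> E})"
  have "cut_rows E X vs vs = (\<Sum>u \<in> set vs \<inter> X. card {v \<in> set vs. v \<notin> X \<and> {u, v} \<in> E})"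
    using assms(2)
    by (simp add: cut_rows_def cut_row_def sum_list_distinct_conv_sum_set distinct_length_filter
        Int_def Collect_conj_eq[symmetric] conj_ac)
  also have "\<dots> = card ?S" by simp
  also have "\<dots> = card ((\<lambda>(u, v). {u, v}) ` ?S)"
    by (rule card_image[symmetric]) (auto simp: inj_on_def doubleton_eq_iff)
  also have "(\<lambda>(u, v). {u, v}) ` ?S = boundary (set vs) E X"
    using assms(1) by (auto simp: boundary_def)
  finally show ?thesis by (simp add: cut_size_def)
qed

text \<open>The expression \<open>g\<close> is the update of the counter, so one loop serves both
  for pushing and for popping.\<close>

definition row_loop :: "exp \<Rightarrow> com" where
  "row_loop g =
    While (Var 16) (
      Cond (Hd (Var 16)) (Cond (Hd (Var 17)) Skip (Assign 11 g)) Skip ;;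
      Assign 16 (Tl (Var 16)) ;;
      Assign 17 (Tl (Var 17)))"

definition cut_com :: "exp \<Rightarrow> nat \<Rightarrow> com" where
  "cut_com g x =
    Assign 12 (Var 2) ;; Assign 13 (Var x) ;;
    While (Var 12) (
      Cond (Hd (Var 13)) (Assign 16 (Hd (Var 12)) ;; Assign 17 (Var x) ;; row_loop g) Skip ;;
      Assign 12 (Tl (Var 12)) ;;
      Assign 13 (Tl (Var 13)))"

lemma wp_row_loop:
  assumes g: "\<And>s. eval_exp g s = f (s 11)"
    and s: "s 16 = enc_list (\<lambda>v. enc_bool ({u, v} \<in> E)) vs" "s 17 = enc_set vs X"
  shows "wp (row_loop g) s ((exp_cost g + 19) * length vs + 2)
    (\<lambda>s'. s' 11 = (f ^^ cut_row E X vs u) (s 11) \<and> same_off {11, 16, 17} s s')"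
  unfolding row_loop_def
proof (rule wp_While[where xs = vs and P = "\<lambda>us s'.
    s' 16 = enc_list (\<lambda>v. enc_bool ({u, v} \<in> E)) us \<and> s' 17 = enc_set us X \<and>
    (f ^^ cut_row E X us u) (s' 11) = (f ^^ cut_row E X vs u) (s 11) \<and> same_off {11, 16, 17} s s'"])
  fix v us s'
  assume P: "s' 16 = enc_list (\<lambda>v. enc_bool ({u, v} \<in> E)) (v # us) \<and> s' 17 = enc_set (v # us) X \<and>
    (f ^^ cut_row E X (v # us) u) (s' 11) = (f ^^ cut_row E X vs u) (s 11) \<and> same_off {11, 16, 17} s s'"
  show "eval_exp (Var 16) s' \<noteq> Atom \<and>
      wp (Cond (Hd (Var 16)) (Cond (Hd (Var 17)) Skip (Assign 11 g)) Skip ;;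
      Assign 16 (Tl (Var 16)) ;;
      Assign 17 (Tl (Var 17))) s' (exp_cost g + 17)
       (\<lambda>s'. s' 16 = enc_list (\<lambda>v. enc_bool ({u, v} \<in> E)) us \<and> s' 17 = enc_set us X \<and>
    (f ^^ cut_row E X us u) (s' 11) = (f ^^ cut_row E X vs u) (s 11) \<and> same_off {11, 16, 17} s s')"
    apply (rule conjI)
    subgoal using P by simp
    apply (rule wp_run_le)
    subgoal by simp
    subgoal by simp
    using P by (cases "v \<in> X"; cases "{u, v} \<in> E")
      (simp_all add: g cut_row_def funpow_Suc_right del: funpow.simps)
qed (use s in \<open>auto simp: cut_row_def\<close>)

lemma wp_cut_com:
  assumes g: "\<And>s. eval_exp g s = f (s 11)"
    and s: "s 2 = enc_graph vs E" "s x = enc_set vs X" and x: "x < 11" and cost: "exp_cost g \<le> 3"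
  shows "wp (cut_com g x) s (30 * (length vs + 1)\<^sup>2)
    (\<lambda>s'. s' 11 = (f ^^ cut_rows E X vs vs) (s 11) \<and> same_off {11, 12, 13, 16, 17} s s')"
proof -
  let ?n = "length vs"
  \<comment> \<open>The bound 3 on the cost of \<open>g\<close> is attained by \<open>push\<close>;
    \<open>pop\<close> costs 2.\<close>
  have le: "(exp_cost g + 19) * ?n \<le> 22 * ?n" using cost by simp
  let ?P = "\<lambda>us s'.
      s' 12 = enc_list (\<lambda>u. enc_list (\<lambda>v. enc_bool ({u, v} \<in> E)) vs) us \<and> s' 13 = enc_set us X \<and>
      (f ^^ cut_rows E X vs us) (s' 11) = (f ^^ cut_rows E X vs vs) (s 11) \<and>
      same_off {11, 12, 13, 16, 17} s s'"
  let ?body = "Cond (Hd (Var 13)) (Assign 16 (Hd (Var 12)) ;; Assign 17 (Var x) ;; row_loop g) Skip ;;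
      Assign 12 (Tl (Var 12)) ;; Assign 13 (Tl (Var 13))"
  have step: "wp ?body s' (22 * ?n + 25) (?P us)" if P: "?P (u # us) s'" for u us s'
    apply (rule wp_le)
     apply (rule wp_Seq)
     apply (rule wp_Cond)
      apply (rule wp_Seq wp_Assign)+
      apply (rule wp_conseq[OF wp_row_loop[where f = f and u = u and E = E and X = X and vs = vs]])
         apply (rule g)
    subgoal using P by simp
    subgoal using P s x by simp
      apply (rule wp_run)
    subgoal by simp
    \<comment> \<open>Commuting the sum puts the applications of \<open>f\<close> for the current
      row innermost, since they happen first.\<close>
    subgoal using P by (simp add: cut_rows_def funpow_add add.commute[of "cut_row E X vs u"])
     apply (rule wp_Skip)
     apply (rule wp_run_le)
    using P by (simp_all add: cut_rows_def trans_le_add2[OF le])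
  have loop: "wp (While (Var 12) ?body) s0 ((22 * ?n + 27) * ?n + 2)
      (\<lambda>s'. s' 11 = (f ^^ cut_rows E X vs vs) (s 11) \<and> same_off {11, 12, 13, 16, 17} s s')"
    if "?P vs s0" for s0
    by (rule wp_While[where P = ?P, OF that conjI[OF _ step]]) (auto simp: cut_rows_def)
  show ?thesis
    unfolding cut_com_def
    apply (rule wp_le)
     apply (rule wp_Seq wp_Assign)+
     apply (rule loop)
    using s x by (auto simp: enc_graph_def power2_eq_square algebra_simps)
qed

lemma pop_push: "(val_tl ^^ m) ((Pair Atom ^^ n) Atom) = Atom \<longleftrightarrow> n \<le> m"
proof (induction m arbitrary: n)
  case 0
  show ?case by (cases n) auto
next
  case (Suc m)
  show ?case
  proof (cases n)
    case 0
    have "(val_tl ^^ k) Atom = Atom" for k by (induction k) auto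
    with 0 show ?thesis by simp
  next
    case (Suc k)
    then show ?thesis using Suc.IH[of k]
      by (simp only: funpow_Suc_right[of m] o_apply funpow.simps(2)[of k] val_tl.simps Suc_le_mono)
  qed
qed

definition push :: exp where
  "push = Cons_exp Nil_exp (Var 11)"

definition pop :: exp where
  "pop = Tl (Var 11)"

subsection \<open>The main loops\<close>

text \<open>A nonempty counter means \<open>d (C - D) > d C\<close>, so the member in 7 is shrunk;
  otherwise the shrunken cluster is already waiting in 9.\<close>

definition step_com :: com where
  "step_com =
    diff_com 5 7 9 ;; Assign 11 Nil_exp ;; cut_com push 9 ;; cut_com pop 5 ;;
    Cond (Var 11)
      (diff_com 7 5 7 ;; Assign 4 (Cons_exp (Var 7) (Var 4)))
      (Assign 5 (Var 9) ;; Assign 4 (Cons_exp (Var 7) (Var 4)))"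

text \<open>With \<open>n = length vs\<close>, the two cut computations take
  \<open>60 * (n + 1)^2\<close> and the differences at most \<open>84 * n + 34\<close>; the rest is
  constant.\<close>

lemma wp_step_com:
  fixes C :: "'a set"
  assumes s: "s 2 = enc_graph vs E" "s 5 = enc_set vs C" "s 7 = enc_set vs D" "s 4 = enc_family vs Ps"
    and sub: "C \<subseteq> set vs" "D \<subseteq> set vs" and "distinct vs"
  defines "d \<equiv> cut_size (set vs) E"
  shows "wp step_com s (160 * (length vs + 1)\<^sup>2)
    (\<lambda>s'. (if d (C - D) \<le> d C then s' 5 = enc_set vs (C - D) \<and> s' 4 = enc_family vs (D # Ps)
        else s' 5 = enc_set vs C \<and> s' 4 = enc_family vs ((D - C) # Ps)) \<and>
      same_off {4, 5, 7, 9, 11, 12, 13, 14, 16, 17} s s')"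
proof -
  have [simp]: "cut_rows E (C - D) vs vs = d (C - D)" "cut_rows E C vs vs = d C"
    using cut_rows_eq_cut_size[of "C - D" vs E] cut_rows_eq_cut_size[of C vs E] sub \<open>distinct vs\<close>
    by (auto simp: d_def)
  show ?thesis
    unfolding step_com_def
    apply (rule wp_le)
     apply (rule wp_Seq)
     apply (rule wp_conseq[OF wp_diff_com[where vs = vs and X = C and Y = D]])
    subgoal using s by simp
    subgoal using s by simp
    subgoal by simp
    subgoal by simp
    subgoal by simp
     apply (rule wp_Seq wp_Assign)+
     apply (rule wp_conseq[OF wp_cut_com[where f = "Pair Atom" and vs = vs and X = "C - D" and E = E]])
    subgoal by (simp add: push_def)
    subgoal using s by simp
    subgoal by simp
    subgoal by simp
    subgoal by (simp add: push_def)
     apply (rule wp_Seq)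
     apply (rule wp_conseq[OF wp_cut_com[where f = val_tl and vs = vs and X = C and E = E]])
    subgoal by (simp add: pop_def)
    subgoal using s by simp
    subgoal using s by simp
    subgoal by simp
    subgoal by (simp add: pop_def)
     apply (rule wp_Cond)
      apply (rule wp_Seq)
      apply (rule wp_conseq[OF wp_diff_com[where vs = vs and X = D and Y = C]])
    subgoal using s by simp
    subgoal using s by simp
    subgoal by simp
    subgoal by simp
    subgoal by simp
      apply (rule wp_run)
    subgoal by simp
    subgoal using s by (simp add: pop_push)
     apply (rule wp_run)
    subgoal by simp
    subgoal using s by (simp add: pop_push)
    by (simp add: power2_eq_square algebra_simps)
qed

section \<open>Inserting one cluster\<close>

definition uncross_com :: com where
  "uncross_com =
    Assign 6 (Var 4) ;; Assign 4 Nil_exp ;;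
    While (Var 6) (Assign 7 (Hd (Var 6)) ;; Assign 6 (Tl (Var 6)) ;; step_com) ;;
    Assign 4 (Cons_exp (Var 5) (Var 4))"

text \<open>The family grows from one insertion to the next; the parameter \<open>m\<close> gives a
  bound common to all insertions, as the outer loop requires.\<close>

lemma wp_uncross_com:
  fixes C :: "'a set"
  assumes s: "s 2 = enc_graph vs E" "s 5 = enc_set vs C" "s 4 = enc_family vs Ds"
    and sub: "C \<subseteq> set vs" "\<forall>D\<in>set Ds. D \<subseteq> set vs" and "distinct vs"
    and m: "length Ds \<le> m"
  defines "d \<equiv> cut_size (set vs) E"
  shows "wp uncross_com s (200 * (length vs + 1)\<^sup>2 * (m + 1))
    (\<lambda>s'. s' 4 = enc_family vs (uncross d C [] Ds) \<and>
      same_off {4, 5, 6, 7, 9, 11, 12, 13, 14, 16, 17} s s')"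
proof -
  let ?k = "(length vs + 1)\<^sup>2"
  let ?same = "same_off {4, 5, 6, 7, 9, 11, 12, 13, 14, 16, 17} s"
  \<comment> \<open>As \<open>uncross\<close> is tail recursive, its value on the current registers
    never changes during the loop.\<close>
  let ?P = "\<lambda>Ds' s'. s' 6 = enc_family vs Ds' \<and> (\<forall>D\<in>set Ds'. D \<subseteq> set vs) \<and> ?same s' \<and>
    (\<exists>C' Ps. s' 5 = enc_set vs C' \<and> s' 4 = enc_family vs Ps \<and> C' \<subseteq> set vs \<and>
      uncross d C' Ps Ds' = uncross d C [] Ds)"
  let ?body = "Assign 7 (Hd (Var 6)) ;; Assign 6 (Tl (Var 6)) ;; step_com"
  have step: "wp ?body s' (160 * ?k + 8) (?P Ds')" if P: "?P (D # Ds') s'" for D Ds' s'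
  proof -
    obtain C' Ps where C': "s' 5 = enc_set vs C'" "s' 4 = enc_family vs Ps" "C' \<subseteq> set vs"
      "uncross d C' Ps (D # Ds') = uncross d C [] Ds" using P by blast
    have P': "s' 6 = enc_family vs (D # Ds')" "\<forall>D\<in>set (D # Ds'). D \<subseteq> set vs" "?same s'"
      using P by blast+
    show ?thesis
      apply (rule wp_le)
       apply (rule wp_Seq wp_Assign)+
       apply (rule wp_conseq[OF wp_step_com[where vs = vs and C = C' and D = D and Ps = Ps and E = E]])
      subgoal using P s by simp
      subgoal using C' by simp
      subgoal using P by simp
      subgoal using C' by simp
      subgoal using C' by simp
      subgoal using P by simp
      subgoal by fact
      subgoal premises Q for s''
      proof (cases "d (C' - D) \<le> d C'")
        case True
        then show ?thesis
          using Q P' C' by (intro conjI exI[of _ "C' - D"] exI[of _ "D # Ps"]) (auto simp: d_def)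
      next
        case False
        then show ?thesis
          using Q P' C' by (intro conjI exI[of _ C'] exI[of _ "(D - C') # Ps"]) (auto simp: d_def)
      qed
      by simp
  qed
  have loop: "wp (While (Var 6) ?body) s0 ((160 * ?k + 10) * m + 2)
      (\<lambda>s'. (\<exists>C' Ps. s' 5 = enc_set vs C' \<and> s' 4 = enc_family vs Ps \<and>
        C' # Ps = uncross d C [] Ds) \<and> ?same s')"
    if "?P Ds s0" for s0
  proof (rule wp_While[where P = ?P, OF that])
    show "eval_exp (Var 6) s' \<noteq> Atom \<and> wp ?body s' (160 * ?k + 8) (?P xs)" if "?P (x # xs) s'" for x xs s'
      using that by (intro conjI step[OF that]) simp
    show "(exp_cost (Var 6) + (160 * ?k + 8) + 1) * length Ds + exp_cost (Var 6) + 1 \<le> (160 * ?k + 10) * m + 2"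
      using m by (simp add: add.commute mult_le_mono)
  qed auto
  \<comment> \<open>These two facts absorb the constants and the terms linear in \<open>m\<close>
    into multiples of \<open>?k\<close> and \<open>m * ?k\<close>.\<close>
  have k: "?k \<ge> 1" by simp
  have m1: "m \<le> m * ?k" using mult_left_mono[OF k, of m] by simp
  show ?thesis
    unfolding uncross_com_def
    apply (rule wp_le)
     apply (rule wp_Seq wp_Assign)+
     apply (rule wp_conseq[OF loop])
    subgoal using s sub by (auto intro!: exI[of _ C] exI[of _ "[]"])
     apply (rule wp_run)
    subgoal by simp
    subgoal by (force simp flip: enc_family_simps)
    apply (simp add: distrib_left distrib_right del: One_nat_def)
    using k m1 by linarith
qed

section \<open>Discarding empty members\<close>

definition nonempty_loop :: com where
  "nonempty_loop =
    While (Var 12) (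
      Cond (Hd (Var 12)) (Assign 13 (Cons_exp Nil_exp Nil_exp)) Skip ;;
      Assign 12 (Tl (Var 12)))"

text \<open>The empty set is encoded by a vector of \<open>Atom\<close> entries, which is itself a
  \<open>Pair\<close> as soon as there is a vertex; emptiness is therefore decided by a scan with
  register 13 as flag.\<close>

lemma wp_nonempty_loop:
  assumes s: "s 12 = enc_set vs X" "s 13 = Atom"
  shows "wp nonempty_loop s (14 * length vs + 2)
    (\<lambda>s'. (s' 13 = Atom \<longleftrightarrow> set vs \<inter> X = {}) \<and> same_off {12, 13} s s')"
  unfolding nonempty_loop_def
proof (rule wp_While[where xs = vs and P = "\<lambda>us s'. s' 12 = enc_set us X \<and>
    ((s' 13 = Atom \<and> set us \<inter> X = {}) \<longleftrightarrow> set vs \<inter> X = {}) \<and> same_off {12, 13} s s'"])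
  fix v us s'
  assume P: "s' 12 = enc_set (v # us) X \<and>
    ((s' 13 = Atom \<and> set (v # us) \<inter> X = {}) \<longleftrightarrow> set vs \<inter> X = {}) \<and> same_off {12, 13} s s'"
  show "eval_exp (Var 12) s' \<noteq> Atom \<and>
    wp (Cond (Hd (Var 12)) (Assign 13 (Cons_exp Nil_exp Nil_exp)) Skip ;;
      Assign 12 (Tl (Var 12))) s' 12
      (\<lambda>s'. s' 12 = enc_set us X \<and>
    ((s' 13 = Atom \<and> set us \<inter> X = {}) \<longleftrightarrow> set vs \<inter> X = {}) \<and> same_off {12, 13} s s')"
    apply (rule conjI)
    subgoal using P by simp
    apply (rule wp_run_le)
    subgoal by simp
    subgoal by simp
    using P by (cases "v \<in> X") simp_all
qed (use s in auto)

definition filter_com :: com where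
  "filter_com =
    Assign 1 Nil_exp ;;
    While (Var 4) (
      Assign 12 (Hd (Var 4)) ;; Assign 13 Nil_exp ;; nonempty_loop ;;
      Cond (Var 13) (Assign 1 (Cons_exp (Hd (Var 4)) (Var 1))) Skip ;;
      Assign 4 (Tl (Var 4)))"

lemma wp_filter_com:
  fixes Ps :: "'a set list"
  assumes s: "s 4 = enc_family vs Ps" and sub: "\<forall>P\<in>set Ps. P \<subseteq> set vs" and m: "length Ps \<le> m"
  shows "wp filter_com s ((14 * length vs + 25) * m + 5)
    (\<lambda>s'. s' 1 = enc_family vs (rev (filter (\<lambda>C. C \<noteq> {}) Ps)))"
proof -
  let ?F = "filter (\<lambda>C :: 'a set. C \<noteq> {})"
  let ?P = "\<lambda>Ps' s'. s' 4 = enc_family vs Ps' \<and> (\<forall>P\<in>set Ps'. P \<subseteq> set vs) \<and>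
    (\<exists>Qs. s' 1 = enc_family vs Qs \<and> rev (?F Ps') @ Qs = rev (?F Ps))"
  let ?body = "Assign 12 (Hd (Var 4)) ;; Assign 13 Nil_exp ;; nonempty_loop ;;
      Cond (Var 13) (Assign 1 (Cons_exp (Hd (Var 4)) (Var 1))) Skip ;;
      Assign 4 (Tl (Var 4))"
  have step: "wp ?body s' (14 * length vs + 23) (?P Ps')" if P: "?P (C # Ps') s'" for C Ps' s'
  proof -
    obtain Qs where Qs: "s' 1 = enc_family vs Qs" "rev (?F (C # Ps')) @ Qs = rev (?F Ps)"
      using P by blast
    \<comment> \<open>The scan sees only listed vertices; it decides emptiness because
      \<open>C\<close> contains no others.\<close>
    have C: "set vs \<inter> C = {} \<longleftrightarrow> C = {}" using P by auto
    have *: "\<exists>Qs'. Pair (enc_set vs C) (enc_family vs Qs) = enc_family vs Qs' \<and>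
        rev (?F Ps') @ Qs' = rev (?F Ps)" if "C \<noteq> {}"
      using Qs that by (intro exI[of _ "C # Qs"]) simp
    show ?thesis
      apply (rule wp_le)
       apply (rule wp_Seq wp_Assign)+
       apply (rule wp_conseq[OF wp_nonempty_loop[where vs = vs and X = C]])
      subgoal using P by simp
      subgoal by simp
       apply (rule wp_run)
      subgoal by simp
      subgoal
        unfolding C using P Qs * by (cases "C = {}") auto
      by simp
  qed
  have loop: "wp (While (Var 4) ?body) s0 ((14 * length vs + 25) * m + 2)
      (\<lambda>s'. s' 1 = enc_family vs (rev (?F Ps)))" if "?P Ps s0" for s0
  proof (rule wp_While[where P = ?P, OF that])
    show "eval_exp (Var 4) s' \<noteq> Atom \<and> wp ?body s' (14 * length vs + 23) (?P xs)" if "?P (x # xs) s'" for x xs s'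
      using that by (intro conjI step[OF that]) simp
    show "(exp_cost (Var 4) + (14 * length vs + 23) + 1) * length Ps + exp_cost (Var 4) + 1 \<le> (14 * length vs + 25) * m + 2"
      using m by (simp add: add.commute mult_le_mono)
  qed auto
  show ?thesis
    unfolding filter_com_def
    apply (rule wp_le)
     apply (rule wp_Seq wp_Assign)+
     apply (rule loop)
    using s sub by (auto intro: exI[of _ "[]"])
qed

section \<open>The whole program\<close>

definition partition_com :: com where
  "partition_com =
    Assign 2 (Hd (Var 0)) ;; Assign 3 (Tl (Var 0)) ;; Assign 4 Nil_exp ;;
    While (Var 3) (Assign 5 (Hd (Var 3)) ;; Assign 3 (Tl (Var 3)) ;; uncross_com) ;;
    filter_com"

text \<open>At most \<open>N\<close> insertions, each with at most \<open>N\<close> uncrossings of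
  quadratic cost, give the fourth power; the final filtering is only quadratic.\<close>

lemma wp_partition_com:
  fixes Cs :: "'a set list"
  assumes s: "s 0 = enc_instance vs E Cs" and sub: "\<forall>C\<in>set Cs. C \<subseteq> set vs" and "distinct vs"
    and n: "length vs \<le> N" and m: "length Cs \<le> N"
  shows "wp partition_com s (300 * (N + 1) ^ 4)
    (\<lambda>s'. s' 1 = enc_family vs (uncross_all (cut_size (set vs) E) Cs))"
proof -
  let ?d = "cut_size (set vs) E"
  let ?R = "\<lambda>Cs Ps. fold (\<lambda>C Ps. uncross ?d C [] Ps) Cs Ps"
  \<comment> \<open>Empty members stay until the end, so each insertion lengthens the family by
    exactly one; the length equation keeps it within \<open>N\<close>.\<close>
  let ?P = "\<lambda>Cs' s'. s' 3 = enc_family vs Cs' \<and> (\<forall>C\<in>set Cs'. C \<subseteq> set vs) \<and> s' 2 = enc_graph vs E \<and>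
    (\<exists>Ps. s' 4 = enc_family vs Ps \<and> ?R Cs' Ps = ?R Cs [] \<and> (\<forall>P\<in>set Ps. P \<subseteq> set vs) \<and>
      length Ps + length Cs' = length Cs)"
  let ?body = "Assign 5 (Hd (Var 3)) ;; Assign 3 (Tl (Var 3)) ;; uncross_com"
  have step: "wp ?body s' (200 * (N + 1) ^ 3 + 8) (?P Cs')" if P: "?P (C # Cs') s'" for C Cs' s'
  proof -
    obtain Ps where Ps: "s' 4 = enc_family vs Ps" "?R (C # Cs') Ps = ?R Cs []"
      "\<forall>P\<in>set Ps. P \<subseteq> set vs" "length Ps + length (C # Cs') = length Cs" using P by blast
    have U: "\<forall>P\<in>set (uncross ?d C [] Ps). P \<subseteq> set vs"
      using Union_uncross[of ?d C "[]" Ps] P Ps(3) by auto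
    have "200 * (length vs + 1)\<^sup>2 * (N + 1) \<le> 200 * (N + 1)\<^sup>2 * (N + 1)"
      using n by (intro mult_right_mono mult_left_mono power_mono) auto
    also have "\<dots> = 200 * (N + 1) ^ 3" by (simp only: power2_eq_square power3_eq_cube mult.assoc)
    finally have le: "200 * (length vs + 1)\<^sup>2 * (N + 1) \<le> 200 * (N + 1) ^ 3" .
    show ?thesis
      apply (rule wp_le)
       apply (rule wp_Seq wp_Assign)+
       apply (rule wp_conseq[OF wp_uncross_com[where vs = vs and C = C and Ds = Ps and E = E and m = N]])
      subgoal using P by simp
      subgoal using P by simp
      subgoal using Ps by simp
      subgoal using P by simp
      subgoal using Ps by simp
      subgoal by fact
      subgoal using Ps m by simp
      subgoal using P Ps U by (auto intro!: exI[of _ "uncross ?d C [] Ps"])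
      using le by (simp del: One_nat_def)
  qed
  have loop: "wp (While (Var 3) ?body) s0 ((200 * (N + 1) ^ 3 + 10) * N + 2)
      (\<lambda>s'. s' 4 = enc_family vs (?R Cs []) \<and> (\<forall>P\<in>set (?R Cs []). P \<subseteq> set vs) \<and>
        length (?R Cs []) = length Cs)" if "?P Cs s0" for s0
  proof (rule wp_While[where P = ?P, OF that])
    show "eval_exp (Var 3) s' \<noteq> Atom \<and> wp ?body s' (200 * (N + 1) ^ 3 + 8) (?P xs)" if "?P (x # xs) s'" for x xs s'
      using that by (intro conjI step[OF that]) simp
    show "(exp_cost (Var 3) + (200 * (N + 1) ^ 3 + 8) + 1) * length Cs + exp_cost (Var 3) + 1 \<le> (200 * (N + 1) ^ 3 + 10) * N + 2"
      using m by (simp add: add.commute mult_le_mono)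
  qed auto
  show ?thesis
    unfolding partition_com_def
    apply (rule wp_le)
     apply (rule wp_Seq wp_Assign)+
     apply (rule wp_conseq[OF loop])
    subgoal using s sub by (auto simp: enc_instance_def)
     apply (rule wp_conseq[OF wp_filter_com[where vs = vs and m = N and Ps = "?R Cs []"]])
    subgoal by blast
    subgoal by blast
    subgoal using m by simp
    subgoal by (simp add: uncross_all_def)
    subgoal
    proof -
      have "(14 * length vs + 25) * N \<le> (14 * N + 25) * N"
        using n by (intro mult_right_mono) auto
      moreover have "(200 * (N + 1) ^ 3 + 10) * N + 2 + ((14 * N + 25) * N + 5) + 20 \<le> 300 * (N + 1) ^ 4"
        by (simp add: power4_eq_xxxx power3_eq_cube algebra_simps)
      ultimately show ?thesis unfolding exp_cost.simps by linarith
    qed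
    done
qed

section \<open>Input size, existence and polynomial time\<close>

lemma length_le_size_enc_list: "length xs \<le> size (enc_list f xs)"
  by (induction xs) auto

theorem lemma1:
  "(\<forall>(V :: 'a set) E (\<mu> :: 'a set \<Rightarrow> nat) (p :: nat) (q :: nat).
      ugraph V E \<longrightarrow> mono_on (Pow V) \<mu> \<longrightarrow>
      (\<forall>v\<in>V. \<exists>C. is_cluster V E \<mu> p q C \<and> v \<in> C) \<longrightarrow>
      (\<exists>P. is_cluster_partition V E \<mu> p q P))
   \<and>
   (\<exists>(c :: com) (B :: nat poly).
      \<forall>(V :: 'a set) E (\<mu> :: 'a set \<Rightarrow> nat) (p :: nat) (q :: nat) vs Cs.
        ugraph V E \<longrightarrow> mono_on (Pow V) \<mu> \<longrightarrow>
        distinct vs \<longrightarrow> set vs = V \<longrightarrow>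
        (\<forall>C\<in>set Cs. is_cluster V E \<mu> p q C) \<longrightarrow> \<Union>(set Cs) = V \<longrightarrow>
        (\<exists>Ps t. computes_in c (enc_instance vs E Cs) (enc_family vs Ps) t
              \<and> t \<le> poly B (size (enc_instance vs E Cs))
              \<and> distinct Ps
              \<and> is_cluster_partition V E \<mu> p q (set Ps)))"
proof (intro conjI allI impI)
  fix V :: "'a set" and E \<mu> p q
  assume G: "ugraph V E" and mu: "mono_on (Pow V) \<mu>"
    and cover: "\<forall>v\<in>V. \<exists>C. is_cluster V E \<mu> p q C \<and> v \<in> C"
  \<comment> \<open>A finite vertex set has only finitely many clusters, so the list of all of them
    can serve as the cover.\<close>
  have "finite {C. is_cluster V E \<mu> p q C}"
    by (rule finite_subset[of _ "Pow V"]) (use G in \<open>auto simp: is_cluster_def ugraph_def\<close>)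
  then obtain Cs where Cs: "set Cs = {C. is_cluster V E \<mu> p q C}"
    using finite_list by blast
  then have "\<Union>(set Cs) = V" using cover by (auto simp: is_cluster_def)
  then show "\<exists>P. is_cluster_partition V E \<mu> p q P"
    using uncross_all_correct(2)[OF G mu] Cs by blast
next
  show "\<exists>(c :: com) (B :: nat poly).
      \<forall>(V :: 'a set) E (\<mu> :: 'a set \<Rightarrow> nat) (p :: nat) (q :: nat) vs Cs.
        ugraph V E \<longrightarrow> mono_on (Pow V) \<mu> \<longrightarrow>
        distinct vs \<longrightarrow> set vs = V \<longrightarrow>
        (\<forall>C\<in>set Cs. is_cluster V E \<mu> p q C) \<longrightarrow> \<Union>(set Cs) = V \<longrightarrow>
        (\<exists>Ps t. computes_in c (enc_instance vs E Cs) (enc_family vs Ps) t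
              \<and> t \<le> poly B (size (enc_instance vs E Cs))
              \<and> distinct Ps
              \<and> is_cluster_partition V E \<mu> p q (set Ps))"
  \<comment> \<open>The factor \<open>[:1, 1:]\<close> is the polynomial \<open>x + 1\<close>, so
    \<open>B\<close> is \<open>300 * (x + 1) ^ 4\<close>.\<close>
  proof (intro exI[of _ partition_com] exI[of _ "[:300:] * [:1, 1:] ^ 4"] allI impI)
    fix V :: "'a set" and E \<mu> p q vs Cs
    assume G: "ugraph V E" and mu: "mono_on (Pow V) \<mu>"
      and vs: "distinct vs" "set vs = V"
      and Cs: "\<forall>C\<in>set Cs. is_cluster V E \<mu> p q C" "\<Union>(set Cs) = V"
    let ?x = "enc_instance vs E Cs" and ?Ps = "uncross_all (cut_size V E) Cs"
    \<comment> \<open>Every list entry contributes a \<open>Pair\<close> to the spine, so the input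
      size can serve as the common bound \<open>N\<close>.\<close>
    have "length vs \<le> size (enc_graph vs E)"
      unfolding enc_graph_def by (rule length_le_size_enc_list)
    moreover have "length Cs \<le> size (enc_family vs Cs)"
      unfolding enc_family_def by (rule length_le_size_enc_list)
    ultimately have "length vs \<le> size ?x" "length Cs \<le> size ?x"
      by (simp_all add: enc_instance_def)
    then have "wp partition_com ((\<lambda>_. Atom)(0 := ?x)) (300 * (size ?x + 1) ^ 4)
        (\<lambda>s'. s' 1 = enc_family vs ?Ps)"
      using wp_partition_com[of "(\<lambda>_. Atom)(0 := ?x)" vs E Cs "size ?x"] vs Cs by auto
    then obtain t where "computes_in partition_com ?x (enc_family vs ?Ps) t" "t \<le> 300 * (size ?x + 1) ^ 4"
      unfolding wp_def computes_in_def by blast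
    then show "\<exists>Ps t. computes_in partition_com ?x (enc_family vs Ps) t
              \<and> t \<le> poly ([:300:] * [:1, 1:] ^ 4) (size ?x)
              \<and> distinct Ps
              \<and> is_cluster_partition V E \<mu> p q (set Ps)"
      using uncross_all_correct[OF G mu Cs] by (intro exI[of _ ?Ps] exI[of _ t]) (auto simp: poly_power)
  qed
qed

end
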